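(* Let $\mathbf{A}=[a_{ij}]$ be an $n\times n$ pairwise comparison matrix and $\mathbf{w}=(w_1,\dots,w_n)^{\top}$ a positive weight vector such that $a_{ij}\ne w_i/w_j$ for all $i\ne j$. Let $I=\{(i,j)\mid a_{ij}<w_i/w_j\}$. Consider the optimization problem in the variables $x_i>0$ ($1\le i\le n$) and $t$: \begin{align*} \min\ t&\\ \frac{x_j}{x_i}\,a_{ij}&\le 1 &&\text{for all }(i,j)\in I,\\ \frac{x_i}{x_j}\,\frac{w_j}{w_i}\,\frac{1}{t}&\le 1 &&\text{for all }(i,j)\in I,\\ 0<t&\le 1,\\ x_1&=1. \end{align*} The optimum value of this problem is at most $1$, and it is equal to $1$ if and only if $\mathbf{w}$ is weakly efficient with respect to $\mathbf{A}$. Moreover, let $(\mathbf{x}^{\ast},t^{\ast})\in\mathbb{R}^{n+1}_{+}$ be an optimal solution; if $\mathbf{w}$ is strongly inefficient, then the weight vector $\mathbf{x}^{\ast}$ is weakly efficient and dominates $\mathbf{w}$ internally and strictly.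
   Context: A pairwise comparison matrix of size $n\times n$ ($n\ge 3$) is a real matrix $\mathbf{A}=[a_{ij}]$ with all entries positive and $a_{ij}=1/a_{ji}$ for all $1\le i,j\le n$. A positive weight vector $\mathbf{w}$ is called weakly efficient (with respect to $\mathbf{A}$) if there is no positive vector $\mathbf{w}'$ such that $|a_{ij}-w'_i/w'_j|<|a_{ij}-w_i/w_j|$ for all $1\le i\ne j\le n$. It is called strongly inefficient if it is not weakly efficient. A positive vector $\mathbf{w}'$ dominates $\mathbf{w}$ internally and strictly if for all $1\le i\ne j\le n$: $a_{ij}\le w_i/w_j$ implies $a_{ij}\le w'_i/w'_j<w_i/w_j$, and $a_{ij}\ge w_i/w_j$ implies $a_{ij}\ge w'_i/w'_j>w_i/w_j$. *)

theory Defs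
  imports "HOL-Analysis.Analysis"
begin

definition positive_vector :: "real ^ 'n \<Rightarrow> bool" where
  "positive_vector w \<longleftrightarrow> (\<forall>i. 0 < w $ i)"

definition pairwise_comparison_matrix :: "real ^ 'n ^ 'n \<Rightarrow> bool" where
  "pairwise_comparison_matrix A \<longleftrightarrow>
     3 \<le> CARD('n) \<and> (\<forall>i j. 0 < A $ i $ j \<and> A $ i $ j = 1 / A $ j $ i)"

definition weakly_efficient :: "real ^ 'n ^ 'n \<Rightarrow> real ^ 'n \<Rightarrow> bool" where
  "weakly_efficient A w \<longleftrightarrow> positive_vector w \<and>
     \<not> (\<exists>w'. positive_vector w' \<and>
          (\<forall>i j. i \<noteq> j \<longrightarrow> \<bar>A $ i $ j - w' $ i / w' $ j\<bar> < \<bar>A $ i $ j - w $ i / w $ j\<bar>))"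

definition strongly_inefficient :: "real ^ 'n ^ 'n \<Rightarrow> real ^ 'n \<Rightarrow> bool" where
  "strongly_inefficient A w \<longleftrightarrow> positive_vector w \<and> \<not> weakly_efficient A w"

text \<open>The dominating vector is the second argument, the dominated one the third.\<close>

definition dominates_internally_strictly ::
    "real ^ 'n ^ 'n \<Rightarrow> real ^ 'n \<Rightarrow> real ^ 'n \<Rightarrow> bool" where
  "dominates_internally_strictly A w' w \<longleftrightarrow> positive_vector w' \<and> positive_vector w \<and>
     (\<forall>i j. i \<noteq> j \<longrightarrow>
        (A $ i $ j \<le> w $ i / w $ j \<longrightarrow>
           A $ i $ j \<le> w' $ i / w' $ j \<and> w' $ i / w' $ j < w $ i / w $ j) \<and>
        (A $ i $ j \<ge> w $ i / w $ j \<longrightarrow>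
           A $ i $ j \<ge> w' $ i / w' $ j \<and> w' $ i / w' $ j > w $ i / w $ j))"

definition index_set :: "real ^ 'n ^ 'n \<Rightarrow> real ^ 'n \<Rightarrow> ('n \<times> 'n) set" where
  "index_set A w = {(i, j). A $ i $ j < w $ i / w $ j}"

text \<open>An abstract index type has no first element, so the index whose variable is
  normalised to 1 is a parameter \<open>k\<close>.\<close>

definition feasible ::
    "real ^ 'n ^ 'n \<Rightarrow> real ^ 'n \<Rightarrow> 'n \<Rightarrow> (real ^ 'n) \<times> real \<Rightarrow> bool" where
  "feasible A w k = (\<lambda>(x, t).
     positive_vector x \<and>
     (\<forall>(i, j) \<in> index_set A w. x $ j / x $ i * A $ i $ j \<le> 1) \<and>
     (\<forall>(i, j) \<in> index_set A w. x $ i / x $ j * (w $ j / w $ i) * (1 / t) \<le> 1) \<and>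
     0 < t \<and> t \<le> 1 \<and>
     x $ k = 1)"

definition optimal_solution ::
    "real ^ 'n ^ 'n \<Rightarrow> real ^ 'n \<Rightarrow> 'n \<Rightarrow> (real ^ 'n) \<times> real \<Rightarrow> bool" where
  "optimal_solution A w k = is_arg_min snd (feasible A w k)"

text \<open>The optimum value is an attained minimum; in particular it is unique if it exists.\<close>

definition optimum_value ::
    "real ^ 'n ^ 'n \<Rightarrow> real ^ 'n \<Rightarrow> 'n \<Rightarrow> real \<Rightarrow> bool" where
  "optimum_value A w k v \<longleftrightarrow> (\<exists>x. optimal_solution A w k (x, v))"

end

theory Submission imports Defs begin

text \<open>
  On the index set \<open>I\<close> the constraints say \<open>a\<^sub>i\<^sub>j \<le> x\<^sub>i / x\<^sub>j \<le> t (w\<^sub>i / w\<^sub>j)\<close>; since exactly one of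
  \<open>(i, k)\<close>, \<open>(k, i)\<close> lies in \<open>I\<close>, they confine \<open>(x, t)\<close> to a compact box, so the minimum is attained.
  The key step is that a feasible \<open>(x, t)\<close> with \<open>x\<close> not weakly efficient can be improved. If \<open>x'\<close>
  beats \<open>x\<close> everywhere, then \<open>x'\<^sub>i / x'\<^sub>j < x\<^sub>i / x\<^sub>j\<close> for \<open>(i, j) \<in> I\<close>, and this persists for
  \<open>x + \<epsilon> x'\<close> in place of \<open>x'\<close>; for small \<open>\<epsilon> > 0\<close> these ratios also stay above \<open>a\<^sub>i\<^sub>j\<close>, so \<open>t\<close> can
  be lowered. Applied to the optimal \<open>x\<close> and to the rescaled \<open>w\<close> (feasible with \<open>t = 1\<close>), this gives
  everything.
\<close>

section \<open>Pairwise comparison matrices and their index sets\<close>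

lemma pairwise_comparison_matrix_pos:
  "pairwise_comparison_matrix A \<Longrightarrow> 0 < A $ i $ j"
  unfolding pairwise_comparison_matrix_def by blast

lemma pairwise_comparison_matrix_recip:
  "pairwise_comparison_matrix A \<Longrightarrow> A $ i $ j = 1 / A $ j $ i"
  unfolding pairwise_comparison_matrix_def by blast

lemma pairwise_comparison_matrix_diag:
  assumes "pairwise_comparison_matrix A"
  shows "A $ i $ i = 1"
proof -
  have "A $ i $ i * A $ i $ i = 1"
    using pairwise_comparison_matrix_recip[OF assms, of i i] pairwise_comparison_matrix_pos[OF assms, of i i]
    by (simp add: field_simps)
  then show ?thesis
    using pairwise_comparison_matrix_pos[OF assms, of i i]
    by (simp add: square_eq_1_iff)
qed

text \<open>Taking reciprocals reverses the inequality between the matrix entry and the weight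
  ratio.\<close>

lemma pairwise_comparison_matrix_exhaust:
  fixes A :: "real ^ 'n ^ 'n"
  assumes A: "pairwise_comparison_matrix A" and w: "positive_vector w"
    and ne: "A $ i $ j \<noteq> w $ i / w $ j"
  shows "(i, j) \<in> index_set A w \<or> (j, i) \<in> index_set A w"
proof (cases "A $ i $ j < w $ i / w $ j")
  case False
  with ne have "w $ i / w $ j < A $ i $ j" by simp
  moreover have "0 < w $ i" "0 < w $ j" using w by (auto simp: positive_vector_def)
  ultimately have "A $ j $ i < w $ j / w $ i"
    using pairwise_comparison_matrix_pos[OF A, of i j]
    unfolding pairwise_comparison_matrix_recip[OF A, of j i]
    by (simp add: field_simps)
  then show ?thesis by (simp add: index_set_def)
qed (simp add: index_set_def)

lemma index_set_neq:
  assumes "pairwise_comparison_matrix A" "positive_vector w" "(i, j) \<in> index_set A w"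
  shows "i \<noteq> j"
proof
  assume "i = j"
  moreover have "0 < w $ i" using assms by (simp add: positive_vector_def)
  ultimately show False
    using assms pairwise_comparison_matrix_diag[OF assms(1), of i] by (simp add: index_set_def)
qed

section \<open>Constraints as bounds on ratios\<close>

text \<open>Positivity allows the denominators to be cleared. The resulting polynomial inequalities
  make sense for all real \<open>x\<close> and \<open>t\<close>, which the closedness argument for
  the feasible set relies on.\<close>

lemma feasible_iff:
  fixes A :: "real ^ 'n ^ 'n"
  assumes "positive_vector w"
  shows "feasible A w k (x, t) \<longleftrightarrow> positive_vector x \<and>
     (\<forall>(i, j) \<in> index_set A w. x $ j * A $ i $ j \<le> x $ i \<and> x $ i * w $ j \<le> t * (w $ i * x $ j)) \<and>
     0 < t \<and> t \<le> 1 \<and> x $ k = 1"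
proof -
  have 1: "x $ j / x $ i * A $ i $ j \<le> 1 \<longleftrightarrow> x $ j * A $ i $ j \<le> x $ i"
    and 2: "0 < t \<Longrightarrow> x $ i / x $ j * (w $ j / w $ i) * (1 / t) \<le> 1 \<longleftrightarrow> x $ i * w $ j \<le> t * (w $ i * x $ j)"
    if "positive_vector x" for i j
  proof -
    have "0 < x $ i" "0 < x $ j" "0 < w $ i"
      using that assms by (auto simp: positive_vector_def)
    then show "x $ j / x $ i * A $ i $ j \<le> 1 \<longleftrightarrow> x $ j * A $ i $ j \<le> x $ i"
      and "0 < t \<Longrightarrow> x $ i / x $ j * (w $ j / w $ i) * (1 / t) \<le> 1 \<longleftrightarrow> x $ i * w $ j \<le> t * (w $ i * x $ j)"
      by (simp_all add: divide_simps mult_ac)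
  qed
  show ?thesis
    unfolding feasible_def using 1 2 by fastforce
qed

text \<open>The factor cancels in every ratio. This carries efficiency over from the normalised
  \<open>w\<close> to \<open>w\<close> itself.\<close>

lemma weakly_efficient_scaleR_iff:
  fixes A :: "real ^ 'n ^ 'n"
  assumes "0 < c"
  shows "weakly_efficient A (c *\<^sub>R x) \<longleftrightarrow> weakly_efficient A x"
  using assms by (simp add: weakly_efficient_def positive_vector_def zero_less_mult_iff)

lemma feasible_index_le:
  fixes A :: "real ^ 'n ^ 'n"
  assumes "positive_vector w" "feasible A w k (x, t)" "(i, j) \<in> index_set A w"
  shows "A $ i $ j \<le> x $ i / x $ j" "x $ i / x $ j \<le> t * (w $ i / w $ j)"
proof -
  have "0 < x $ j" "0 < w $ j" "x $ j * A $ i $ j \<le> x $ i" "x $ i * w $ j \<le> t * (w $ i * x $ j)"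
    using assms by (auto simp: feasible_iff positive_vector_def)
  then show "A $ i $ j \<le> x $ i / x $ j" "x $ i / x $ j \<le> t * (w $ i / w $ j)"
    by (simp_all add: field_simps)
qed

text \<open>The inequalities over the index set see only ratios, so the normalisation at
  \<open>k\<close> can be imposed afterwards by rescaling.\<close>

lemma feasible_scaleR:
  fixes A :: "real ^ 'n ^ 'n"
  assumes w: "positive_vector w" and y: "positive_vector y" and t: "0 < t" "t \<le> 1"
    and le: "\<And>i j. (i, j) \<in> index_set A w \<Longrightarrow> A $ i $ j \<le> y $ i / y $ j"
    and ge: "\<And>i j. (i, j) \<in> index_set A w \<Longrightarrow> y $ i / y $ j \<le> t * (w $ i / w $ j)"
  shows "feasible A w k ((1 / y $ k) *\<^sub>R y, t)"
proof -
  have pos: "0 < w $ i" "0 < y $ i" for i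
    using w y by (auto simp: positive_vector_def)
  have "y $ j * A $ i $ j \<le> y $ i" "y $ i * w $ j \<le> t * (w $ i * y $ j)" 
    if "(i, j) \<in> index_set A w" for i j
    using le[OF that] ge[OF that] pos[of i] pos[of j] by (simp_all add: field_simps)
  then have "y $ j / y $ k * A $ i $ j \<le> y $ i / y $ k"
    "y $ i / y $ k * w $ j \<le> t * (w $ i * (y $ j / y $ k))"
    if "(i, j) \<in> index_set A w" for i j
    using that pos[of k] by (simp_all add: divide_right_mono)
  moreover have "y $ k \<noteq> 0" using pos(2)[of k] by simp
  ultimately show ?thesis
    using pos t by (simp add: feasible_iff[OF w] positive_vector_def split_beta)
qed

lemma feasible_normalized:
  fixes A :: "real ^ 'n ^ 'n"
  assumes w: "positive_vector w"
  shows "feasible A w k ((1 / w $ k) *\<^sub>R w, 1)"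
proof -
  have pos: "0 < w $ i" for i using w by (simp add: positive_vector_def)
  have "w $ j * A $ i $ j \<le> w $ i" if "(i, j) \<in> index_set A w" for i j
    using that pos[of j] by (simp add: index_set_def field_simps)
  then show ?thesis
    using w pos by (intro feasible_scaleR) (auto simp: field_simps)
qed

section \<open>Improving a feasible point\<close>

text \<open>The ratios of \<open>x'\<close> may overshoot and fall below \<open>A\<close>, so
  \<open>x\<close> is moved only slightly towards \<open>x'\<close>. The new ratios are continuous
  in the step size, hence finitely many strict lower bounds survive a small step.\<close>

lemma exists_strictly_between:
  fixes A :: "real ^ 'n ^ 'n"
  assumes x: "positive_vector x" and x': "positive_vector x'"
    and lt: "\<And>i j. (i, j) \<in> I \<Longrightarrow> A $ i $ j < x $ i / x $ j"
    and lt': "\<And>i j. (i, j) \<in> I \<Longrightarrow> x' $ i / x' $ j < x $ i / x $ j"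
  obtains y where "positive_vector y"
    "\<And>i j. (i, j) \<in> I \<Longrightarrow> A $ i $ j < y $ i / y $ j \<and> y $ i / y $ j < x $ i / x $ j"
proof -
  have pos: "0 < x $ i" "0 < x' $ i" for i
    using x x' by (auto simp: positive_vector_def)
  have "\<forall>\<^sub>F e in at_right 0. \<forall>(i, j)\<in>I. A $ i $ j < (x + e *\<^sub>R x') $ i / (x + e *\<^sub>R x') $ j"
  proof (rule eventually_ball_finite, simp, safe)
    fix i j assume ij: "(i, j) \<in> I"
    have "((\<lambda>e. (x + e *\<^sub>R x') $ i / (x + e *\<^sub>R x') $ j) \<longlongrightarrow> (x + 0 *\<^sub>R x') $ i / (x + 0 *\<^sub>R x') $ j) (at_right 0)"
      using pos[of j] by (intro tendsto_intros) auto
    then show "\<forall>\<^sub>F e in at_right 0. A $ i $ j < (x + e *\<^sub>R x') $ i / (x + e *\<^sub>R x') $ j"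
      using lt[OF ij] by (auto intro: order_tendstoD)
  qed
  then have "\<forall>\<^sub>F e in at_right (0::real). 0 < e \<and>
      (\<forall>(i, j)\<in>I. A $ i $ j < (x + e *\<^sub>R x') $ i / (x + e *\<^sub>R x') $ j)"
    by (intro eventually_conj eventually_at_right_less)
  then obtain e where e: "0 < e"
    and low: "\<And>i j. (i, j) \<in> I \<Longrightarrow> A $ i $ j < (x + e *\<^sub>R x') $ i / (x + e *\<^sub>R x') $ j"
    by (auto dest!: eventually_happens'[OF trivial_limit_at_right_real])
  show ?thesis
  proof
    show "positive_vector (x + e *\<^sub>R x')"
      using pos e by (simp add: positive_vector_def add_pos_pos)
    fix i j assume ij: "(i, j) \<in> I"
    \<comment> \<open>The new ratio is the mediant of the ratios of \<open>x\<close> and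
      \<open>x'\<close>, so it lies strictly below the larger one.\<close>
    have "e * (x' $ i * x $ j) < e * (x $ i * x' $ j)"
      using lt'[OF ij] pos[of i] pos[of j] e by (simp add: field_simps)
    moreover have "0 < x $ j + e * x' $ j" using pos e by (simp add: add_pos_pos)
    ultimately have "(x + e *\<^sub>R x') $ i / (x + e *\<^sub>R x') $ j < x $ i / x $ j"
      using pos[of j] by (simp add: divide_simps algebra_simps)
    with low[OF ij] show "A $ i $ j < (x + e *\<^sub>R x') $ i / (x + e *\<^sub>R x') $ j \<and>
        (x + e *\<^sub>R x') $ i / (x + e *\<^sub>R x') $ j < x $ i / x $ j" ..
  qed
qed

lemma feasible_improve:
  fixes A :: "real ^ 'n ^ 'n"
  assumes A: "pairwise_comparison_matrix A" and w: "positive_vector w"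
    and feas: "feasible A w k (x, t)" and ineff: "\<not> weakly_efficient A x"
  shows "\<exists>y s. feasible A w k (y, s) \<and> s < t"
proof -
  let ?I = "index_set A w"
  have x: "positive_vector x" and t: "0 < t" "t \<le> 1"
    using feas by (auto simp: feasible_iff[OF w])
  have wpos: "0 < w $ i" for i using w by (simp add: positive_vector_def)
  obtain x' where x': "positive_vector x'" and better:
      "\<And>i j. i \<noteq> j \<Longrightarrow> \<bar>A $ i $ j - x' $ i / x' $ j\<bar> < \<bar>A $ i $ j - x $ i / x $ j\<bar>"
    using x ineff by (auto simp: weakly_efficient_def)
  \<comment> \<open>A strictly smaller error forces the error of \<open>x\<close> to be nonzero. As
    the ratio of \<open>x\<close> lies above the entry of \<open>A\<close>, coming closer means
    going down.\<close>
  have lt: "A $ i $ j < x $ i / x $ j" and lt': "x' $ i / x' $ j < x $ i / x $ j"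
    if "(i, j) \<in> ?I" for i j
    using better[OF index_set_neq[OF A w that]] feasible_index_le(1)[OF w feas that] by auto
  obtain y where y: "positive_vector y" and between:
    "\<And>i j. (i, j) \<in> ?I \<Longrightarrow> A $ i $ j < y $ i / y $ j \<and> y $ i / y $ j < x $ i / x $ j"
    using exists_strictly_between[OF x x' lt lt'] by blast
  have ypos: "0 < y $ i" for i using y by (simp add: positive_vector_def)
  \<comment> \<open>the extra element \<open>t / 2\<close> only spares a case distinction on \<open>I\<close> being empty\<close>
  define R where "R = insert (t / 2) ((\<lambda>(i, j). (y $ i / y $ j) * (w $ j / w $ i)) ` ?I)"
  have R: "finite R" "R \<noteq> {}" by (simp_all add: R_def)
  have "r < t \<and> 0 < r" if "r \<in> R" for r
  proof -
    have "(y $ i / y $ j) * (w $ j / w $ i) < t \<and> 0 < (y $ i / y $ j) * (w $ j / w $ i)"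
      if ij: "(i, j) \<in> ?I" for i j
    proof -
      have "y $ i / y $ j < t * (w $ i / w $ j)"
        using between[OF ij] feasible_index_le(2)[OF w feas ij] by linarith
      then show ?thesis
        using wpos[of i] wpos[of j] ypos[of i] ypos[of j] by (simp add: field_simps)
    qed
    then show ?thesis using that t by (auto simp: R_def)
  qed
  \<comment> \<open>The maximum of finitely many numbers below \<open>t\<close> is below
    \<open>t\<close>; it serves as the new objective value.\<close>
  with R have s: "Max R < t" "0 < Max R" by simp_all
  have "y $ i / y $ j \<le> Max R * (w $ i / w $ j)" if ij: "(i, j) \<in> ?I" for i j
  proof -
    have "(y $ i / y $ j) * (w $ j / w $ i) \<le> Max R"
      using ij R(1) by (intro Max_ge) (auto simp: R_def)
    then show ?thesis
      using wpos[of i] wpos[of j] ypos[of j] by (simp add: field_simps)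
  qed
  then have "feasible A w k ((1 / y $ k) *\<^sub>R y, Max R)"
    using w y s t between by (intro feasible_scaleR) (auto simp: less_imp_le)
  with s show ?thesis by blast
qed

section \<open>Internal strict dominance\<close>

text \<open>With \<open>t < 1\<close> the upper constraint puts the ratios of \<open>x\<close>
  strictly below those of \<open>w\<close> on the index set. Reciprocals settle the transposed
  pairs.\<close>

lemma feasible_imp_dominates:
  fixes A :: "real ^ 'n ^ 'n"
  assumes A: "pairwise_comparison_matrix A" and w: "positive_vector w"
    and ne: "\<And>i j. i \<noteq> j \<Longrightarrow> A $ i $ j \<noteq> w $ i / w $ j"
    and feas: "feasible A w k (x, t)" and t: "t < 1"
  shows "dominates_internally_strictly A x w"
proof -
  have x: "positive_vector x"
    using feas by (auto simp: feasible_iff[OF w])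
  have pos: "0 < x $ i" "0 < w $ i" for i
    using x w by (auto simp: positive_vector_def)
  have I: "A $ i $ j \<le> x $ i / x $ j \<and> x $ i / x $ j < w $ i / w $ j"
    if ij: "(i, j) \<in> index_set A w" for i j
  proof -
    have "t * (w $ i / w $ j) < 1 * (w $ i / w $ j)"
      using t pos by (intro mult_strict_right_mono) auto
    then show ?thesis using feasible_index_le[OF w feas ij] by auto
  qed
  have J: "x $ i / x $ j \<le> A $ i $ j \<and> w $ i / w $ j < x $ i / x $ j"
    if ij: "(j, i) \<in> index_set A w" for i j
    using I[OF ij] pos[of i] pos[of j] pairwise_comparison_matrix_pos[OF A, of j i]
    unfolding pairwise_comparison_matrix_recip[OF A, of i j] by (simp add: field_simps)
  have "(A $ i $ j \<le> w $ i / w $ j \<longrightarrow> A $ i $ j \<le> x $ i / x $ j \<and> x $ i / x $ j < w $ i / w $ j) \<and>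
    (A $ i $ j \<ge> w $ i / w $ j \<longrightarrow> A $ i $ j \<ge> x $ i / x $ j \<and> x $ i / x $ j > w $ i / w $ j)"
    if "i \<noteq> j" for i j
  proof (cases "A $ i $ j < w $ i / w $ j")
    case True
    then show ?thesis using I[of i j] by (simp add: index_set_def)
  next
    case False
    then have "(j, i) \<in> index_set A w"
      using pairwise_comparison_matrix_exhaust[OF A w ne[OF that]] by (auto simp: index_set_def)
    with False ne[OF that] show ?thesis using J[of j i] by auto
  qed
  then show ?thesis using x w by (simp add: dominates_internally_strictly_def)
qed

lemma dominates_internally_strictly_imp_inefficient:
  fixes A :: "real ^ 'n ^ 'n"
  assumes "dominates_internally_strictly A x w"
  shows "\<not> weakly_efficient A w"
proof -
  have "\<bar>A $ i $ j - x $ i / x $ j\<bar> < \<bar>A $ i $ j - w $ i / w $ j\<bar>" if "i \<noteq> j" for i j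
    using assms that linear[of "A $ i $ j" "w $ i / w $ j"]
    unfolding dominates_internally_strictly_def by fastforce
  then show ?thesis
    using assms by (auto simp: weakly_efficient_def dominates_internally_strictly_def)
qed

section \<open>Existence of an optimum\<close>

text \<open>Since \<open>x $ k = 1\<close>, the component \<open>x $ i\<close> is the ratio for the
  pair \<open>(i, k)\<close>. It lies between the entry of \<open>A\<close> and the ratio of
  \<open>w\<close>; their order depends on which of \<open>(i, k)\<close> and \<open>(k, i)\<close>
  is in the index set.\<close>

lemma feasible_bounds:
  fixes A :: "real ^ 'n ^ 'n"
  assumes A: "pairwise_comparison_matrix A" and w: "positive_vector w"
    and ne: "\<And>i j. i \<noteq> j \<Longrightarrow> A $ i $ j \<noteq> w $ i / w $ j"
    and feas: "feasible A w k (x, t)"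
  shows "min (A $ i $ k) (w $ i / w $ k) \<le> x $ i" "x $ i \<le> max (A $ i $ k) (w $ i / w $ k)"
proof -
  have xk: "x $ k = 1" and t: "t \<le> 1" and xpos: "0 < x $ i" and wpos: "0 < w $ i" "0 < w $ k"
    using feas w by (auto simp: feasible_iff[OF w] positive_vector_def)
  have le: "x $ p / x $ q \<le> w $ p / w $ q" if "(p, q) \<in> index_set A w" for p q
  proof -
    have "0 < w $ p" "0 < w $ q" using w by (auto simp: positive_vector_def)
    then have "t * (w $ p / w $ q) \<le> 1 * (w $ p / w $ q)"
      using t by (intro mult_right_mono) auto
    then show ?thesis using feasible_index_le(2)[OF w feas that] by linarith
  qed
  consider "i = k" | "(i, k) \<in> index_set A w" | "(k, i) \<in> index_set A w"
    using pairwise_comparison_matrix_exhaust[OF A w ne] by blast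
  then have "min (A $ i $ k) (w $ i / w $ k) \<le> x $ i \<and> x $ i \<le> max (A $ i $ k) (w $ i / w $ k)"
  proof cases
    case 1
    then show ?thesis using xk pairwise_comparison_matrix_diag[OF A] wpos by simp
  next
    case 2
    then show ?thesis using feasible_index_le(1)[OF w feas 2] le[OF 2] xk by simp
  next
    case 3
    have "A $ k $ i \<le> 1 / x $ i" "1 / x $ i \<le> w $ k / w $ i"
      using feasible_index_le(1)[OF w feas 3] le[OF 3] xk by simp_all
    then have "x $ i \<le> A $ i $ k" "w $ i / w $ k \<le> x $ i"
      using xpos wpos pairwise_comparison_matrix_pos[OF A, of k i]
      unfolding pairwise_comparison_matrix_recip[OF A, of i k] by (simp_all add: field_simps)
    then show ?thesis by simp
  qed
  then show "min (A $ i $ k) (w $ i / w $ k) \<le> x $ i" "x $ i \<le> max (A $ i $ k) (w $ i / w $ k)"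
    by simp_all
qed

lemma optimal_solution_exists:
  fixes A :: "real ^ 'n ^ 'n"
  assumes A: "pairwise_comparison_matrix A" and w: "positive_vector w"
    and ne: "\<And>i j. i \<noteq> j \<Longrightarrow> A $ i $ j \<noteq> w $ i / w $ j"
  shows "\<exists>x t. optimal_solution A w k (x, t)"
proof -
  have wpos: "0 < w $ i" for i using w by (simp add: positive_vector_def)
  have "3 \<le> CARD('n)"
    using A unfolding pairwise_comparison_matrix_def by blast
  then have "card {k} < CARD('n)" by simp
  then obtain i where "i \<noteq> k"
    by (metis UNIV_eq_I card_mono finite.emptyI finite_insert insertI1 linorder_not_less singletonD subsetI)
  then obtain p q where pq: "(p, q) \<in> index_set A w"
    using pairwise_comparison_matrix_exhaust[OF A w ne] by blast
  define l :: "real ^ 'n" where "l = (\<chi> i. min (A $ i $ k) (w $ i / w $ k))"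
  define u :: "real ^ 'n" where "u = (\<chi> i. max (A $ i $ k) (w $ i / w $ k))"
  \<comment> \<open>The constraints at \<open>(p, q)\<close> combine to \<open>c \<le> t\<close>.
    This positive bound replaces the open condition \<open>0 < t\<close>, just as the box with lower
    corner \<open>l\<close> replaces positivity of \<open>x\<close>.\<close>
  define c where "c = A $ p $ q * (w $ q / w $ p)"
  have lpos: "0 < l $ i" for i
    using wpos pairwise_comparison_matrix_pos[OF A] by (simp add: l_def)
  have cpos: "0 < c"
    using wpos pairwise_comparison_matrix_pos[OF A] by (simp add: c_def)
  define C where "C = {z :: (real ^ 'n) \<times> real.
     (\<forall>i j. (i, j) \<in> index_set A w \<longrightarrow> fst z $ j * A $ i $ j \<le> fst z $ i \<and>
        fst z $ i * w $ j \<le> snd z * (w $ i * fst z $ j)) \<and> fst z $ k = 1}"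
  define K where "K = (cbox l u \<times> {c..1}) \<inter> C"
  have "closed C"
  proof -
    have "closed {z :: (real ^ 'n) \<times> real. fst z $ j * A $ i $ j \<le> fst z $ i}"
      and "closed {z :: (real ^ 'n) \<times> real. fst z $ i * w $ j \<le> snd z * (w $ i * fst z $ j)}"
      and "closed {z :: (real ^ 'n) \<times> real. fst z $ i = 1}" for i j
      by (intro closed_Collect_le closed_Collect_eq continuous_intros)+
    then show ?thesis
      \<comment> \<open>Membership in the index set does not depend on the point \<open>z\<close>,
        so this premise defines an open set and the implication a closed one.\<close>
      unfolding C_def by (intro closed_Collect_conj closed_Collect_all closed_Collect_imp open_Collect_const)
  qed
  then have "compact K"
    unfolding K_def by (intro compact_Int_closed compact_Times compact_cbox) auto
  have feas_iff: "feasible A w k z \<longleftrightarrow> z \<in> K" for z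
  proof (cases z)
    case (Pair x t)
    have "x \<in> cbox l u \<and> c \<le> t" if f: "feasible A w k (x, t)"
    proof
      show "x \<in> cbox l u"
        using feasible_bounds[OF A w ne f] by (auto simp: mem_box_cart l_def u_def)
      have "A $ p $ q \<le> t * (w $ p / w $ q)"
        using feasible_index_le[OF w f pq] by linarith
      then show "c \<le> t"
        using wpos[of p] wpos[of q] by (simp add: c_def field_simps)
    qed
    moreover have "positive_vector x" if "x \<in> cbox l u"
      unfolding positive_vector_def
      using that lpos by (meson less_le_trans mem_box_cart(2))
    ultimately show ?thesis
      using cpos unfolding Pair K_def C_def feasible_iff[OF w] by auto
  qed
  have "K \<noteq> {}"
    using feasible_normalized[OF w, of A k] feas_iff by blast
  then obtain z where "z \<in> K" "\<And>y. y \<in> K \<Longrightarrow> snd z \<le> snd y"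
    using continuous_attains_inf[OF \<open>compact K\<close>, of snd] continuous_on_snd[OF continuous_on_id] by blast
  then have "optimal_solution A w k (fst z, snd z)"
    by (force simp: optimal_solution_def is_arg_min_def feas_iff)
  then show ?thesis by blast
qed

section \<open>Optimal solutions and efficiency\<close>

lemma optimal_solution_feasible:
  "optimal_solution A w k (x, t) \<Longrightarrow> feasible A w k (x, t)"
  by (simp add: optimal_solution_def is_arg_min_def)

lemma optimal_solution_le:
  "optimal_solution A w k (x, t) \<Longrightarrow> feasible A w k (y, s) \<Longrightarrow> t \<le> s"
  by (auto simp: optimal_solution_def is_arg_min_def not_less)

lemma optimal_solution_weakly_efficient:
  assumes "pairwise_comparison_matrix A" "positive_vector w" "optimal_solution A w k (x, t)"
  shows "weakly_efficient A x"
  using feasible_improve[OF assms(1,2) optimal_solution_feasible[OF assms(3)]]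
    optimal_solution_le[OF assms(3)] by fastforce

lemma optimal_solution_eq_1_iff:
  fixes A :: "real ^ 'n ^ 'n"
  assumes A: "pairwise_comparison_matrix A" and w: "positive_vector w"
    and ne: "\<And>i j. i \<noteq> j \<Longrightarrow> A $ i $ j \<noteq> w $ i / w $ j"
    and opt: "optimal_solution A w k (x, t)"
  shows "t = 1 \<longleftrightarrow> weakly_efficient A w"
proof
  assume "t = 1"
  \<comment> \<open>The normalised \<open>w\<close> is feasible with value 1, hence optimal here,
    and an optimal point admits no improvement.\<close>
  then have "weakly_efficient A ((1 / w $ k) *\<^sub>R w)"
    using feasible_improve[OF A w feasible_normalized[OF w]] optimal_solution_le[OF opt] by fastforce
  moreover have "0 < 1 / w $ k" using w by (simp add: positive_vector_def)
  ultimately show "weakly_efficient A w"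
    using weakly_efficient_scaleR_iff by blast
next
  assume "weakly_efficient A w"
  then have "\<not> t < 1"
    using feasible_imp_dominates[OF A w ne optimal_solution_feasible[OF opt]]
      dominates_internally_strictly_imp_inefficient by blast
  then show "t = 1"
    using optimal_solution_le[OF opt feasible_normalized[OF w]] by simp
qed

theorem proposition5p1:
  fixes A :: "real ^ 'n ^ 'n" and w :: "real ^ 'n" and k :: 'n
  assumes "pairwise_comparison_matrix A"
    and "positive_vector w"
    and "\<And>i j. i \<noteq> j \<Longrightarrow> A $ i $ j \<noteq> w $ i / w $ j"
  shows "(\<exists>v. optimum_value A w k v \<and> v \<le> 1 \<and> (v = 1 \<longleftrightarrow> weakly_efficient A w)) \<and>
    (\<forall>x t. optimal_solution A w k (x, t) \<longrightarrow> strongly_inefficient A w \<longrightarrow>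
       weakly_efficient A x \<and> dominates_internally_strictly A x w)"
proof (intro conjI allI impI)
  note prems = assms
  obtain x t where opt: "optimal_solution A w k (x, t)"
    using optimal_solution_exists[OF prems] by blast
  show "\<exists>v. optimum_value A w k v \<and> v \<le> 1 \<and> (v = 1 \<longleftrightarrow> weakly_efficient A w)"
    using opt optimal_solution_le[OF opt feasible_normalized[OF prems(2)]]
      optimal_solution_eq_1_iff[OF prems opt] by (auto simp: optimum_value_def)
next
  fix x t
  assume opt: "optimal_solution A w k (x, t)" and "strongly_inefficient A w"
  then show "weakly_efficient A x"
    using optimal_solution_weakly_efficient[OF assms(1,2)] by blast
  have "t < 1"
    using optimal_solution_le[OF opt feasible_normalized[OF assms(2)]]
      optimal_solution_eq_1_iff[OF assms opt] \<open>strongly_inefficient A w\<close>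
    by (simp add: strongly_inefficient_def)
  then show "dominates_internally_strictly A x w"
    using feasible_imp_dominates[OF assms optimal_solution_feasible[OF opt]] by blast
qed

end
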